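(* There is a constant $c>0$ such that for every sufficiently large integer $n$ there exist an instance of the broadcast game on a graph with $n$ vertices (with edge costs satisfying the triangle inequality) and a finite sequence of arrival and departure events, with no improving moves, which, started from the empty state, ends in a state that is a Nash equilibrium whose social cost is at least $c\, n^{1/3}$ times the cost of a minimum spanning tree on all $n$ vertices of the graph.
   Context: A broadcast game is given by an undirected graph $G=(V,E)$ with a designated root $r\in V$ and nonnegative edge costs $c_e$ satisfying the triangle inequality. Agents reside at vertices of $G$ (several agents may reside at the same vertex). A state assigns to each currently active agent a path in $G$ from her vertex to $r$. Costs are shared by the Shapley scheme: the cost of each edge is divided equally among all active agents whose path uses that edge, and an agent's shared cost is the sum of her shares over the edges of her path. A state is a Nash equilibrium if no active agent can strictly lower her shared cost by unilaterally changing her path. The social cost of a state is the sum of $c_e$ over all edges used by at least one active agent's path. The state evolves from the empty state (no active agents) by the following events: Arrival: a set of new agents joins, and each new agent chooses a least-shared-cost (best response) path to $r$ given the current state; Departure: a subset of the active agents leaves the game; Move (improving move): an active agent changes her path to one giving her strictly smaller shared cost. *)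

theory Defs
  imports Complex_Main
begin

fun path_edges :: "'v list \<Rightarrow> 'v set set" where
  "path_edges (x # y # zs) = insert {x, y} (path_edges (y # zs))"
| "path_edges _ = {}"

definition is_path :: "'v set \<Rightarrow> 'v set set \<Rightarrow> 'v \<Rightarrow> 'v list \<Rightarrow> 'v \<Rightarrow> bool" where
  "is_path V E u p v \<longleftrightarrow>
     p \<noteq> [] \<and> hd p = u \<and> last p = v \<and> distinct p \<and> set p \<subseteq> V \<and> path_edges p \<subseteq> E"

definition connected_graph :: "'v set \<Rightarrow> 'v set set \<Rightarrow> bool" where
  "connected_graph V E \<longleftrightarrow> (\<forall>u\<in>V. \<forall>v\<in>V. \<exists>p. is_path V E u p v)"

text \<open>A cycle is given by a path with at least three vertices together with
  the edge joining its last vertex to its first.\<close>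

definition acyclic_graph :: "'v set \<Rightarrow> 'v set set \<Rightarrow> bool" where
  "acyclic_graph V E \<longleftrightarrow>
     \<not> (\<exists>u v p. is_path V E u p v \<and> 3 \<le> length p \<and> {v, u} \<in> E)"

definition spanning_tree :: "'v set \<Rightarrow> 'v set set \<Rightarrow> 'v set set \<Rightarrow> bool" where
  "spanning_tree V E T \<longleftrightarrow> T \<subseteq> E \<and> connected_graph V T \<and> acyclic_graph V T"

text \<open>The map \<open>home\<close> places every potential agent at a vertex; it need not be injective.
  Edges are two-element vertex sets.\<close>

record ('v, 'a) broadcast =
  verts :: "'v set"
  edges :: "'v set set"
  rootv :: 'v
  cost :: "'v set \<Rightarrow> real"
  home :: "'a \<Rightarrow> 'v"

text \<open>Since the graph need not be complete, the triangle inequality is required in the form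
  that no edge costs more than a path between its endpoints. This implies
  \<open>c(uw) \<le> c(uv) + c(vw)\<close> for all triangles, and is equivalent to it on complete graphs.\<close>

definition broadcast_game :: "('v, 'a) broadcast \<Rightarrow> bool" where
  "broadcast_game G \<longleftrightarrow>
     finite (verts G) \<and>
     (\<forall>e\<in>edges G. e \<subseteq> verts G \<and> card e = 2) \<and>
     connected_graph (verts G) (edges G) \<and>
     rootv G \<in> verts G \<and>
     (\<forall>e\<in>edges G. 0 \<le> cost G e) \<and>
     (\<forall>u v p. {u, v} \<in> edges G \<and> is_path (verts G) (edges G) u p v \<longrightarrow>
        cost G {u, v} \<le> (\<Sum>e\<in>path_edges p. cost G e)) \<and>
     (\<forall>a. home G a \<in> verts G)"

definition mst_cost :: "('v, 'a) broadcast \<Rightarrow> real" where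
  "mst_cost G =
     Min ((\<lambda>T. \<Sum>e\<in>T. cost G e) ` {T. spanning_tree (verts G) (edges G) T})"

text \<open>The domain of a state is the set of active agents.\<close>

type_synonym ('v, 'a) state = "'a \<Rightarrow> 'v list option"

definition strategy :: "('v, 'a) broadcast \<Rightarrow> 'a \<Rightarrow> 'v list \<Rightarrow> bool" where
  "strategy G a p \<longleftrightarrow> is_path (verts G) (edges G) (home G a) p (rootv G)"

definition load :: "('v, 'a) state \<Rightarrow> 'v set \<Rightarrow> nat" where
  "load s e = card {a \<in> dom s. e \<in> path_edges (the (s a))}"

definition shared_cost :: "('v, 'a) broadcast \<Rightarrow> ('v, 'a) state \<Rightarrow> 'a \<Rightarrow> real" where
  "shared_cost G s a = (\<Sum>e\<in>path_edges (the (s a)). cost G e / real (load s e))"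

definition social_cost :: "('v, 'a) broadcast \<Rightarrow> ('v, 'a) state \<Rightarrow> real" where
  "social_cost G s = (\<Sum>e\<in>(\<Union>a\<in>dom s. path_edges (the (s a))). cost G e)"

definition nash_equilibrium :: "('v, 'a) broadcast \<Rightarrow> ('v, 'a) state \<Rightarrow> bool" where
  "nash_equilibrium G s \<longleftrightarrow>
     (\<forall>a\<in>dom s. \<not> (\<exists>p. strategy G a p \<and> shared_cost G (s(a \<mapsto> p)) a < shared_cost G s a))"

definition best_response :: "('v, 'a) broadcast \<Rightarrow> ('v, 'a) state \<Rightarrow> 'a \<Rightarrow> 'v list \<Rightarrow> bool" where
  "best_response G s a p \<longleftrightarrow>
     strategy G a p \<and>
     (\<forall>q. strategy G a q \<longrightarrow> shared_cost G (s(a \<mapsto> p)) a \<le> shared_cost G (s(a \<mapsto> q)) a)"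

text \<open>The agents of an arriving set \<open>A\<close> join one after another, in some order, each best
  responding to the state she finds, which includes those of \<open>A\<close> who joined before her.\<close>

inductive arrival ::
  "('v, 'a) broadcast \<Rightarrow> ('v, 'a) state \<Rightarrow> 'a set \<Rightarrow> ('v, 'a) state \<Rightarrow> bool"
  for G :: "('v, 'a) broadcast" and s :: "('v, 'a) state" where
  empty: "arrival G s {} s"
| join: "arrival G s A t \<Longrightarrow> a \<notin> dom s \<union> A \<Longrightarrow> best_response G t a p \<Longrightarrow>
    arrival G s (insert a A) (t(a \<mapsto> p))"

definition departure :: "('v, 'a) state \<Rightarrow> 'a set \<Rightarrow> ('v, 'a) state \<Rightarrow> bool" where
  "departure s A t \<longleftrightarrow> A \<subseteq> dom s \<and> t = s |` (- A)"

definition event :: "('v, 'a) broadcast \<Rightarrow> ('v, 'a) state \<Rightarrow> ('v, 'a) state \<Rightarrow> bool" where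
  "event G s t \<longleftrightarrow> (\<exists>A. arrival G s A t \<or> departure s A t)"

end

theory Submission
  imports Defs
begin

text \<open>
  Take \<open>K\<^sup>2\<close> columns, disjoint paths of unit edges from the root up to level \<open>K\<close>, with
  \<open>K\<^sup>3 < n \<le> (K + 1)\<^sup>3\<close>. On every level above the first the columns are grouped into \<open>K\<close>
  clusters whose members are joined by very short edges. Writing a column as a pair \<open>(x, y)\<close>,
  the clusters are given by \<open>x\<close> on even and by \<open>y\<close> on odd levels, so no two columns are close
  on two consecutive levels. Connecting the clusters by single unit edges gives a spanning
  tree of cost \<open>O(K\<^sup>2)\<close>, whereas all columns together cost \<open>K\<^sup>3\<close>.

  Suppose that every column carries about \<open>t\<close> agents living at its top. To add an agent to one
  column, let a huge number of helpers arrive at its vertices, level by level from the bottom.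
  A helper finds the lower part of her column almost free and pays about \<open>1 / (t + 1)\<close> for one
  more edge. Leaving the column forces her to use at least two foreign edges, of cost at
  least \<open>1 / (t + 2)\<close> each, and some short edges, which is no cheaper. Finally the new agent
  arrives at the top and the helpers depart. Once all columns carry \<open>n\<close> agents, switching
  to another column saves less than a single short edge costs, so the state is an equilibrium.
\<close>

subsection \<open>Paths, loads and spanning trees\<close>

lemma path_edges_subset_Pow: "path_edges p \<subseteq> Pow (set p)"
  by (induction p rule: path_edges.induct) auto

lemma finite_path_edges [simp]: "finite (path_edges p)"
  by (induction p rule: path_edges.induct) auto

lemma path_edges_Cons: "p \<noteq> [] \<Longrightarrow> path_edges (x # p) = insert {x, hd p} (path_edges p)"
  by (cases p) auto

lemma nth_edge_in_path_edges: "Suc k < length p \<Longrightarrow> {p ! k, p ! Suc k} \<in> path_edges p"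
proof (induction p arbitrary: k rule: path_edges.induct)
  case (1 x y zs)
  then show ?case by (cases k) auto
qed auto

lemma is_path_Cons:
  assumes "is_path V E y p v" "x \<in> V" "x \<notin> set p" "{x, y} \<in> E"
  shows "is_path V E x (x # p) v"
  using assms unfolding is_path_def by (auto simp: path_edges_Cons)

lemma is_path_tl:
  assumes "is_path V E x (x # p) v" "p \<noteq> []"
  shows "is_path V E (hd p) p v" "{x, hd p} \<in> E"
  using assms unfolding is_path_def by (auto simp: path_edges_Cons)

lemma is_path_mono: "is_path V T u p v \<Longrightarrow> T \<subseteq> E \<Longrightarrow> is_path V E u p v"
  unfolding is_path_def by (meson order_trans)

text \<open>The drops of \<phi> telescope along the path. The sum ranges over a set of edges, so the
  induction uses that a simple path does not repeat its first edge.\<close>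

lemma potential_le_path_weight:
  fixes \<phi> :: "'v \<Rightarrow> real"
  assumes "is_path V E u p v"
    and "\<And>x y. {x, y} \<in> E \<Longrightarrow> \<phi> x - \<phi> y \<le> w {x, y}"
  shows "\<phi> u - \<phi> v \<le> sum w (path_edges p)"
  using assms(1)
proof (induction p arbitrary: u)
  case Nil
  then show ?case by (simp add: is_path_def)
next
  case (Cons x p)
  have [simp]: "x = u" using Cons.prems by (simp add: is_path_def)
  show ?case
  proof (cases "p = []")
    case True
    then show ?thesis using Cons.prems by (simp add: is_path_def)
  next
    case False
    have p: "is_path V E (hd p) p v" "{u, hd p} \<in> E"
      using is_path_tl[of V E u p v] Cons.prems False by auto
    have "{u, hd p} \<notin> path_edges p"
      using Cons.prems path_edges_subset_Pow[of p] by (auto simp: is_path_def)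
    then have "sum w (path_edges (x # p)) = w {u, hd p} + sum w (path_edges p)"
      using False by (simp add: path_edges_Cons)
    then show ?thesis using Cons.IH[OF p(1)] assms(2)[OF p(2)] by simp
  qed
qed

lemma is_path_if_rtranclp:
  assumes "(\<lambda>x y. x \<in> V \<and> {x, y} \<in> E)\<^sup>*\<^sup>* u v" "v \<in> V"
  shows "\<exists>p. is_path V E u p v"
  using assms(1)
proof (induction rule: converse_rtranclp_induct)
  case base
  have "is_path V E v [v] v" using assms(2) by (simp add: is_path_def)
  then show ?case by blast
next
  case (step x y)
  then obtain p where p: "is_path V E y p v" by blast
  show ?case
  proof (cases "x \<in> set p")
    case False
    then show ?thesis using is_path_Cons[OF p] step by blast
  next
    case True
    \<comment> \<open>If the new first vertex already lies on the path, the suffix starting there is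
      cut out.\<close>
    have "\<exists>q. is_path V E x q v"
      if "is_path V E z p' v" "x \<in> set p'" for p' z
      using that
    proof (induction p' arbitrary: z)
      case (Cons a p')
      show ?case
      proof (cases "a = x")
        case True
        then have "is_path V E x (a # p') v" using Cons.prems by (auto simp: is_path_def)
        then show ?thesis by blast
      next
        case False
        then have "x \<in> set p'" "p' \<noteq> []" using Cons.prems by auto
        moreover have "is_path V E (hd p') p' v"
          using is_path_tl[of V E a p' v] Cons.prems \<open>p' \<noteq> []\<close> by (auto simp: is_path_def)
        ultimately show ?thesis using Cons.IH by blast
      qed
    qed simp
    then show ?thesis using p True by blast
  qed
qed

text \<open>Following parents leads every vertex down to \<open>0\<close>, which gives
  connectedness. The largest vertex of a cycle would have two distinct smaller neighbours on it, but
  its only smaller neighbour is its parent.\<close>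

lemma spanning_tree_if_parent:
  fixes f :: "nat \<Rightarrow> nat"
  assumes f: "\<And>v. 0 < v \<Longrightarrow> v < n \<Longrightarrow> f v < v"
    and E: "\<And>v. 0 < v \<Longrightarrow> v < n \<Longrightarrow> {v, f v} \<in> E"
  shows "spanning_tree {..<n} E ((\<lambda>v. {v, f v}) ` {0<..<n})"
    (is "spanning_tree _ _ ?T")
proof -
  let ?R = "\<lambda>x y. x \<in> {..<n} \<and> {x, y} \<in> ?T"
  have to0: "?R\<^sup>*\<^sup>* v 0 \<and> ?R\<^sup>*\<^sup>* 0 v" if "v < n" for v
    using that
  proof (induction v rule: less_induct)
    case (less v)
    show ?case
    proof (cases "v = 0")
      case False
      then have "f v < v" using f less.prems by simp
      then have IH: "?R\<^sup>*\<^sup>* (f v) 0" "?R\<^sup>*\<^sup>* 0 (f v)" using less by auto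
      have "{v, f v} \<in> ?T" using less.prems False by auto
      then have "?R v (f v)" "?R (f v) v"
        using less.prems \<open>f v < v\<close> by (auto simp: insert_commute)
      show ?thesis
      proof
        show "?R\<^sup>*\<^sup>* v 0" by (rule converse_rtranclp_into_rtranclp[where r = ?R]) fact+
        show "?R\<^sup>*\<^sup>* 0 v" by (rule rtranclp.rtrancl_into_rtrancl[where r = ?R]) fact+
      qed
    qed simp
  qed
  have "connected_graph {..<n} ?T"
    unfolding connected_graph_def
  proof (intro ballI)
    fix u v assume "u \<in> {..<n}" "v \<in> {..<n}"
    then have "?R\<^sup>*\<^sup>* u v" using to0 by (meson lessThan_iff rtranclp_trans)
    then show "\<exists>p. is_path {..<n} ?T u p v"
      using is_path_if_rtranclp \<open>v \<in> {..<n}\<close> by fast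
  qed
  moreover have "acyclic_graph {..<n} ?T"
    unfolding acyclic_graph_def
  proof (rule notI, elim exE conjE)
    fix u v p
    assume p: "is_path {..<n} ?T u p v" and len: "3 \<le> length p" and close: "{v, u} \<in> ?T"
    define m where "m = Max (set p)"
    have "p \<noteq> []" using len by auto
    then have "m \<in> set p" unfolding m_def by simp
    then obtain k where k: "k < length p" "p ! k = m" by (auto simp: in_set_conv_nth)
    have max: "x \<le> m" if "x \<in> set p" for x using that unfolding m_def by simp
    have par: "x = f m" if mx: "{m, x} \<in> ?T" and x: "x \<in> set p" for x
    proof -
      obtain w where w: "w \<in> {0<..<n}" "{m, x} = {w, f w}" using mx by blast
      then have "m = w \<and> x = f w \<or> m = f w \<and> x = w" by (simp add: doubleton_eq_iff)
      then show ?thesis using f[of w] w(1) max[OF x] by auto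
    qed
    have dist: "distinct p" and sub: "path_edges p \<subseteq> ?T"
      and u: "u = p ! 0" and v: "v = p ! (length p - 1)"
      using p \<open>p \<noteq> []\<close> by (auto simp: is_path_def hd_conv_nth last_conv_nth)
    have nxt: "{p ! i, p ! Suc i} \<in> ?T" if "Suc i < length p" for i
      using nth_edge_in_path_edges[OF that] sub by blast
    \<comment> \<open>The positions of the two neighbours of \<open>m\<close> on the cycle, wrapping
      around at the ends of the list. They differ because the cycle has at least three
      vertices.\<close>
    define i where "i = (if k = 0 then length p - 1 else k - 1)"
    define j where "j = (if k = length p - 1 then 0 else Suc k)"
    have "i < length p" "j < length p" "i \<noteq> j" using len k by (auto simp: i_def j_def)
    have "{m, p ! i} \<in> ?T"
    proof (cases "k = 0")
      case True
      then show ?thesis using close u v k by (simp add: i_def insert_commute)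
    next
      case False
      then show ?thesis using nxt[of "k - 1"] k by (simp add: i_def insert_commute)
    qed
    moreover have "{m, p ! j} \<in> ?T"
    proof (cases "k = length p - 1")
      case True
      then show ?thesis using close u v k by (simp add: j_def)
    next
      case False
      then have "Suc k < length p" using k by simp
      then show ?thesis using nxt[of k] k False by (simp add: j_def)
    qed
    ultimately have "p ! i = p ! j"
      using par \<open>i < length p\<close> \<open>j < length p\<close> by (metis nth_mem)
    then show False
      using dist \<open>i < length p\<close> \<open>j < length p\<close> \<open>i \<noteq> j\<close> by (simp add: nth_eq_iff_index_eq)
  qed
  ultimately show ?thesis using E by (auto simp: spanning_tree_def)
qed

text \<open>A newcomer raises each load on her path by one, so she faces a shortest path problem
  whose edge weights are fixed by the current state.\<close>

lemma shared_cost_upd: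
  assumes "finite (dom s)" "a \<notin> dom s"
  shows "shared_cost G (s(a \<mapsto> q)) a
    = (\<Sum>e\<in>path_edges q. cost G e / (real (load s e) + 1))"
proof -
  have "load (s(a \<mapsto> q)) e = Suc (load s e)" if "e \<in> path_edges q" for e
  proof -
    have "{b \<in> dom (s(a \<mapsto> q)). e \<in> path_edges (the ((s(a \<mapsto> q)) b))}
        = insert a {b \<in> dom s. e \<in> path_edges (the (s b))}"
      using assms that by auto
    then show ?thesis using assms by (simp add: load_def)
  qed
  then show ?thesis by (simp add: shared_cost_def add.commute)
qed

subsection \<open>The graph\<close>

text \<open>The test \<open>N = 0\<close> makes the recursion terminate. Truncated subtraction takes
  a vertex of level 1 to the root, where the list ends.\<close>

fun column_path :: "nat \<Rightarrow> nat \<Rightarrow> nat list" where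
  "column_path N v = (if N = 0 \<or> v = 0 then [0] else v # column_path N (v - N))"

declare column_path.simps [simp del]

text \<open>The bound says that the root and \<open>K\<close> full levels of \<open>K * K\<close>
  vertices fit among the numbers below \<open>n\<close>; the remaining vertices form further
  levels.\<close>

locale layered =
  fixes K n :: nat
  assumes K_pos: "0 < K" and n_gt: "K ^ 3 < n"
begin

text \<open>Vertex \<open>0\<close> is the root, and the levels above it consist of \<open>N\<close> consecutive numbers each.
  The vertex below \<open>v\<close> is \<open>v - N\<close>, which by truncation is the root if \<open>v\<close> is on level \<open>1\<close>.
  The last level may be incomplete.\<close>

definition N :: nat where "N = K * K"

definition lev :: "nat \<Rightarrow> nat" where
  "lev v = (if v = 0 then 0 else Suc ((v - 1) div N))"

definition col :: "nat \<Rightarrow> nat" where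
  "col v = (v - 1) mod N"

text \<open>The level is part of the value, so no cluster spans two levels. On level 1 the clusters
  are singletons: all columns meet at the root just below, so short edges there would allow a switch
  of columns at the price of one foreign edge.\<close>

definition clu :: "nat \<Rightarrow> nat \<times> nat" where
  "clu v = (lev v, if lev v \<le> 1 then col v
     else if even (lev v) then col v div K else col v mod K)"

lemma N_pos: "0 < N"
  using K_pos by (simp add: N_def)

lemma n_pos: "0 < n"
  using n_gt by simp

lemma lev_0 [simp]: "lev 0 = 0"
  by (simp add: lev_def)

lemma lev_eq_0_iff [simp]: "lev v = 0 \<longleftrightarrow> v = 0"
  by (simp add: lev_def)

lemma lev_parent: "0 < v \<Longrightarrow> lev v = Suc (lev (v - N))"
proof (cases "v \<le> N")
  case False
  then have "(v - 1) div N = Suc ((v - N - 1) div N)"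
    using N_pos by (subst le_div_geq) (auto simp: diff_commute)
  then show ?thesis using False by (simp add: lev_def)
qed (simp add: lev_def)

lemma col_parent: "N < v \<Longrightarrow> col (v - N) = col v"
  unfolding col_def by (subst (2) le_mod_geq) (auto simp: diff_commute)

lemma vertex_eq: "0 < v \<Longrightarrow> v = Suc ((lev v - 1) * N + col v)"
  by (simp add: lev_def col_def)

lemma lev_col_inj: "0 < u \<Longrightarrow> 0 < v \<Longrightarrow> lev u = lev v \<Longrightarrow> col u = col v \<Longrightarrow> u = v"
  using vertex_eq[of u] vertex_eq[of v] by simp

lemma lev_clu: "clu u = clu v \<Longrightarrow> lev u = lev v"
  by (simp add: clu_def)

lemma clu_col_inj: "clu u = clu v \<Longrightarrow> col u = col v \<Longrightarrow> u = v"
  using lev_col_inj lev_clu by (metis lev_eq_0_iff gr0I)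

lemma clu_level_1: "clu u = clu v \<Longrightarrow> u \<le> N \<Longrightarrow> u = v"
proof -
  assume a: "clu u = clu v" "u \<le> N"
  then have "lev u \<le> 1" using N_pos by (auto simp: lev_def)
  then have "col u = col v" using a lev_clu[OF a(1)] by (simp add: clu_def)
  then show "u = v" using a clu_col_inj by blast
qed

text \<open>On two consecutive levels a column is matched once by its quotient and once by its
  remainder modulo \<open>K\<close>, so no other column is adjacent to it on both: joining a foreign
  column for a single level is impossible.\<close>

lemma clu_consecutive:
  assumes "clu u = clu v" "clu (u - N) = clu (v - N)"
  shows "u = v"
proof (cases "u \<le> N \<or> u - N \<le> N \<or> v \<le> N")
  case True
  then consider "u \<le> N" | "v \<le> N" | "N < u" "N < v" "u - N \<le> N" by linarith
  then show ?thesis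
  proof cases
    case 1 then show ?thesis using assms clu_level_1 by blast
  next
    case 2 then show ?thesis using assms clu_level_1 by metis
  next
    case 3
    then have "u - N = v - N" using assms clu_level_1 by blast
    then show ?thesis using 3 by simp
  qed
next
  case False
  have l: "lev u = lev v" using assms lev_clu by blast
  have l': "lev u = Suc (lev (u - N))" "lev v = Suc (lev (v - N))"
    using False lev_parent by auto
  have "lev (u - N) = Suc (lev (u - N - N))" "0 < lev (u - N - N)"
    using False lev_parent by auto
  then have "2 \<le> lev (u - N)" by simp
  then have "col u div K = col v div K \<and> col u mod K = col v mod K"
    using assms l l' False col_parent[of u] col_parent[of v]
    by (auto simp: clu_def split: if_splits)
  then have "col u = col v" by (metis div_mult_mod_eq)
  then show ?thesis using clu_col_inj assms by blast
qed

section \<open>Edges, costs and the triangle inequality\<close>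

definition E :: "nat set set" where
  "E = {{v, v - N} |v. 0 < v \<and> v < n} \<union> {{x, y} |x y. x < n \<and> y < n \<and> x \<noteq> y \<and> clu x = clu y}"

text \<open>Small enough that the short edges of a spanning tree cost at most 1 in total, and large
  enough to cover the saving on a foreign column once each column carries \<open>n\<close>
  agents.\<close>

definition \<delta> :: real where "\<delta> = 1 / real n"

text \<open>Taking agent names modulo \<open>n\<close> gives every vertex an unlimited supply of
  agents.\<close>

definition G :: "(nat, nat) broadcast" where
  "G = \<lparr>verts = {..<n}, edges = E, rootv = 0,
        cost = (\<lambda>e. if \<exists>v>0. e = {v, v - N} then 1 else \<delta>), home = (\<lambda>a. a mod n)\<rparr>"

lemma G_simps [simp]: "verts G = {..<n}" "edges G = E" "rootv G = 0" "home G a = a mod n"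
  by (simp_all add: G_def)

lemma cost_G: "cost G e = (if \<exists>v>0. e = {v, v - N} then 1 else \<delta>)"
  by (simp add: G_def)

lemma \<delta>_pos: "0 < \<delta>"
  using n_pos by (simp add: \<delta>_def)

lemma \<delta>_le_1: "\<delta> \<le> 1"
  using n_pos by (simp add: \<delta>_def)

lemma cost_pos: "0 < cost G e" and \<delta>_le_cost: "\<delta> \<le> cost G e"
  unfolding cost_G using \<delta>_pos \<delta>_le_1 by simp_all

lemma cost_vertical: "0 < v \<Longrightarrow> cost G {v, v - N} = 1"
  unfolding cost_G by (rule if_P) blast

lemma vertical_eq_iff: "0 < u \<Longrightarrow> 0 < v \<Longrightarrow> {u, u - N} = {v, v - N} \<longleftrightarrow> u = v"
  using N_pos by (auto simp: doubleton_eq_iff)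

lemma horizontal_neq_vertical: "clu x = clu y \<Longrightarrow> 0 < v \<Longrightarrow> {x, y} \<noteq> {v, v - N}"
  using lev_clu[of x y] lev_parent[of v] by (auto simp: doubleton_eq_iff)

lemma cost_horizontal: "clu x = clu y \<Longrightarrow> cost G {x, y} = \<delta>"
  unfolding cost_G by (rule if_not_P) (use horizontal_neq_vertical in blast)

lemma edge_cases:
  assumes "{x, y} \<in> E"
  obtains (down) "0 < x" "x < n" "y = x - N" | (up) "0 < y" "y < n" "x = y - N"
    | (hor) "x < n" "y < n" "x \<noteq> y" "clu x = clu y"
  using assms by (auto simp: E_def doubleton_eq_iff)

lemma vertical_in_E: "0 < v \<Longrightarrow> v < n \<Longrightarrow> {v, v - N} \<in> E"
  by (auto simp: E_def)

lemma finite_E: "finite E"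
  by (rule finite_subset[of _ "Pow {..<n}"]) (auto simp: E_def)

lemma connected_G: "connected_graph {..<n} E"
proof -
  have st: "spanning_tree {..<n} E ((\<lambda>v. {v, v - N}) ` {0<..<n})"
    by (rule spanning_tree_if_parent) (use N_pos vertical_in_E in auto)
  then show ?thesis
    unfolding spanning_tree_def connected_graph_def by (meson is_path_mono)
qed

text \<open>Along every edge the level changes by at most the cost, so a path between the ends of a
  vertical edge costs at least 1. A path between the ends of a short edge has at least one edge, and
  every edge costs at least \<delta>.\<close>

lemma triangle_inequality:
  assumes e: "{u, v} \<in> E" and p: "is_path {..<n} E u p v"
  shows "cost G {u, v} \<le> (\<Sum>e\<in>path_edges p. cost G e)"
proof -
  have lev_le: "\<bar>real (lev x) - real (lev y)\<bar> \<le> cost G {x, y}" if "{x, y} \<in> E" for x y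
    using that
  proof (cases rule: edge_cases)
    case down
    then have "lev x = Suc (lev y)" "cost G {x, y} = 1"
      using lev_parent[of x] cost_vertical[of x] by simp_all
    then show ?thesis by simp
  next
    case up
    then have "lev y = Suc (lev x)" "cost G {x, y} = 1"
      using lev_parent[of y] cost_vertical[of y] by (simp_all add: insert_commute)
    then show ?thesis by simp
  next
    case hor
    then have "lev x = lev y" using lev_clu by blast
    then show ?thesis using cost_pos[of "{x, y}"] by simp
  qed
  have pot: "real (lev u) - real (lev v) \<le> sum (cost G) (path_edges p)"
    by (rule potential_le_path_weight[OF p]) (use lev_le abs_le_D1 in blast)
  have "- real (lev u) - (- real (lev v)) \<le> sum (cost G) (path_edges p)"
    by (rule potential_le_path_weight[OF p]) (use lev_le in fastforce)
  then have pot': "real (lev v) - real (lev u) \<le> sum (cost G) (path_edges p)" by simp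
  show ?thesis
    using e
  proof (cases rule: edge_cases)
    case down
    then show ?thesis using pot lev_parent[of u] by (simp add: cost_vertical)
  next
    case up
    then show ?thesis using pot' lev_parent[of v] cost_vertical[of v] by (simp add: insert_commute)
  next
    case hor
    then obtain x y zs where "p = x # y # zs"
      using p unfolding is_path_def by (cases p rule: path_edges.cases) auto
    then have "{x, y} \<in> path_edges p" by simp
    then have "cost G {x, y} \<le> (\<Sum>e\<in>path_edges p. cost G e)"
      by (intro member_le_sum) (auto intro: less_imp_le cost_pos)
    then show ?thesis using \<delta>_le_cost[of "{x, y}"] hor by (simp add: cost_horizontal)
  qed
qed

lemma broadcast_game_G: "broadcast_game G"
proof -
  have "e \<subseteq> {..<n} \<and> card e = 2" if "e \<in> E" for e
    using that N_pos by (auto simp: E_def card_insert_if)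
  then show ?thesis
    unfolding broadcast_game_def
    using n_pos connected_G less_imp_le[OF cost_pos] triangle_inequality by simp
qed

subsection \<open>Column states\<close>

text \<open>The relation includes \<open>v\<close> itself but never the root, so that the
  \<open>u\<close> below \<open>v\<close> correspond exactly to the edges \<open>{u, u - N}\<close>
  of the column path from \<open>v\<close>.\<close>

definition below :: "nat \<Rightarrow> nat \<Rightarrow> bool" where
  "below u v \<longleftrightarrow> 0 < u \<and> col u = col v \<and> lev u \<le> lev v"

lemma below_pos: "below u v \<Longrightarrow> 0 < u"
  by (simp add: below_def)

lemma not_below_0 [simp]: "\<not> below u 0"
  by (auto simp: below_def)

lemma below_refl: "0 < v \<Longrightarrow> below v v"
  by (simp add: below_def)

lemma below_trans: "below u v \<Longrightarrow> below v w \<Longrightarrow> below u w"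
  by (simp add: below_def)

lemma below_iff_parent:
  assumes "0 < v"
  shows "below u v \<longleftrightarrow> u = v \<or> below u (v - N)"
proof (cases "v \<le> N")
  case True
  then have "lev v = 1" using assms lev_parent by simp
  then have "below u v \<Longrightarrow> lev u = lev v"
    by (auto simp: below_def le_Suc_eq)
  then show ?thesis using True assms lev_col_inj[of u v] below_refl by (auto simp: below_def)
next
  case False
  then have "lev v = Suc (lev (v - N))" "col (v - N) = col v"
    using assms lev_parent col_parent by auto
  then show ?thesis using assms lev_col_inj[of u v] by (auto simp: below_def le_Suc_eq)
qed

lemma below_le: "below u v \<Longrightarrow> u \<le> v"
proof (induction v rule: less_induct)
  case (less v)
  then have "0 < v" by (cases v) auto
  then show ?case using less.IH[of "v - N"] less.prems below_iff_parent[of v u] N_pos by auto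
qed

lemma finite_below: "finite {u. below u v}"
  by (rule finite_subset[of _ "{..v}"]) (auto dest: below_le)

abbreviation col_path :: "nat \<Rightarrow> nat list" where
  "col_path \<equiv> column_path N"

lemma col_path_0: "col_path 0 = [0]"
  by (simp add: column_path.simps)

lemma col_path_rec: "0 < v \<Longrightarrow> col_path v = v # col_path (v - N)"
  using N_pos by (subst column_path.simps) simp

lemma col_path_facts:
  "col_path v \<noteq> [] \<and> hd (col_path v) = v \<and> last (col_path v) = 0 \<and> distinct (col_path v)
    \<and> set (col_path v) = insert 0 {u. below u v}
    \<and> path_edges (col_path v) = {{u, u - N} |u. below u v}"
proof (induction v rule: less_induct)
  case (less v)
  show ?case
  proof (cases "v = 0")
    case False
    then have v: "0 < v" "v - N < v" using N_pos by auto
    note IH = less.IH[OF v(2)]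
    have eq: "{u. below u v} = insert v {u. below u (v - N)}"
      using below_iff_parent[OF v(1)] by auto
    have "v \<notin> set (col_path (v - N))"
      using IH below_le[of v "v - N"] v by auto
    moreover have "{{u, u - N} |u. below u v} = insert {v, v - N} {{u, u - N} |u. below u (v - N)}"
      using below_iff_parent[OF v(1)] by auto
    ultimately show ?thesis
      using IH eq v col_path_rec[OF v(1)] by (auto simp: path_edges_Cons)
  qed (simp add: col_path_0)
qed

lemma is_path_col_path:
  assumes "v < n"
  shows "is_path {..<n} E v (col_path v) 0"
proof -
  have "below u v \<Longrightarrow> 0 < u \<and> u < n" for u
    using below_le[of u v] below_pos[of u v] assms by auto
  then show ?thesis
    using col_path_facts[of v] n_pos unfolding is_path_def by (auto intro!: vertical_in_E)
qed

text \<open>In all states that occur every agent uses her own column, so the set of active agents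
  determines the state.\<close>

definition st :: "nat set \<Rightarrow> (nat, nat) state" where
  "st A a = (if a \<in> A then Some (col_path (a mod n)) else None)"

text \<open>For positive \<open>u\<close> this is the load of the edge from \<open>u\<close> down to
  \<open>u - N\<close>: its users are the agents living at \<open>u\<close> or higher up in the same
  column.\<close>

definition ld :: "nat set \<Rightarrow> nat \<Rightarrow> nat" where
  "ld A u = card {a \<in> A. below u (a mod n)}"

lemma dom_st [simp]: "dom (st A) = A"
  by (auto simp: st_def split: if_splits)

lemma st_insert: "(st A)(a \<mapsto> col_path (a mod n)) = st (insert a A)"
  by (rule ext) (simp add: st_def)

lemma ld_mono: "finite B \<Longrightarrow> A \<subseteq> B \<Longrightarrow> ld A u \<le> ld B u"
  unfolding ld_def by (intro card_mono) auto

lemma ld_insert: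
  assumes "finite A" "a \<notin> A"
  shows "ld (insert a A) u = ld A u + (if below u (a mod n) then 1 else 0)"
proof (cases "below u (a mod n)")
  case True
  then have "{b \<in> insert a A. below u (b mod n)} = insert a {b \<in> A. below u (b mod n)}" by auto
  then show ?thesis using assms True by (simp add: ld_def)
next
  case False
  then have "{b \<in> insert a A. below u (b mod n)} = {b \<in> A. below u (b mod n)}" by auto
  then show ?thesis using False by (simp add: ld_def)
qed

lemma vertical_in_col_path: "0 < u \<Longrightarrow> {u, u - N} \<in> path_edges (col_path v) \<longleftrightarrow> below u v"
  using col_path_facts[of v] vertical_eq_iff[of u] below_pos[of _ v] by blast

lemma load_vertical: "0 < u \<Longrightarrow> load (st A) {u, u - N} = ld A u"
proof -
  assume "0 < u"
  then have "{a \<in> A. {u, u - N} \<in> path_edges (the (st A a))} = {a \<in> A. below u (a mod n)}"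
    using vertical_in_col_path by (auto simp: st_def)
  then show ?thesis by (simp add: load_def ld_def)
qed

lemma load_horizontal:
  assumes "clu x = clu y"
  shows "load (st A) {x, y} = 0"
proof -
  have "{x, y} \<notin> path_edges (col_path v)" for v
  proof
    assume "{x, y} \<in> path_edges (col_path v)"
    then obtain u where "below u v" "{x, y} = {u, u - N}" using col_path_facts[of v] by blast
    then show False using horizontal_neq_vertical[OF assms below_pos] by blast
  qed
  then have "{a \<in> A. {x, y} \<in> path_edges (the (st A a))} = {}"
    by (auto simp: st_def)
  then show ?thesis unfolding load_def dom_st by (metis card.empty)
qed

text \<open>A potential that is tight along the agent's own column certifies, by shortest-path
  duality, that the column is a best response.\<close>

lemma best_response_if_potential:
  fixes \<phi> :: "nat \<Rightarrow> real"
  assumes A: "finite A" "a \<notin> A" and v: "a mod n = v" and \<phi>0: "\<phi> 0 = 0"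
    and vert: "\<And>u. 0 < u \<Longrightarrow> \<bar>\<phi> u - \<phi> (u - N)\<bar> \<le> 1 / (real (ld A u) + 1)"
    and hor: "\<And>x y. x \<noteq> y \<Longrightarrow> clu x = clu y \<Longrightarrow> \<phi> x - \<phi> y \<le> \<delta>"
    and own: "\<And>u. below u v \<Longrightarrow> \<phi> u - \<phi> (u - N) = 1 / (real (ld A u) + 1)"
  shows "best_response G (st A) a (col_path v)"
proof -
  \<comment> \<open>The share a newcomer would pay on each edge, herself included among its
    users.\<close>
  define w where "w e = cost G e / (real (load (st A) e) + 1)" for e
  have w_vert: "w {u, u - N} = 1 / (real (ld A u) + 1)" if "0 < u" for u
    using that by (simp add: w_def cost_vertical load_vertical)
  have lip: "\<phi> x - \<phi> y \<le> w {x, y}" if "{x, y} \<in> E" for x y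
    using that
  proof (cases rule: edge_cases)
    case down
    then show ?thesis using vert[of x] w_vert[of x] by auto
  next
    case up
    then show ?thesis using vert[of y] w_vert[of y] by (auto simp: insert_commute)
  next
    case hor
    then show ?thesis
      using assms(6)[of x y] by (simp add: w_def cost_horizontal load_horizontal)
  qed
  have sc: "shared_cost G ((st A)(a \<mapsto> q)) a = sum w (path_edges q)" for q
    using A by (subst shared_cost_upd) (auto simp: w_def)
  have tight: "sum w (path_edges (col_path u)) = \<phi> u" if "u = 0 \<or> below u v" for u
    using that
  proof (induction u rule: less_induct)
    case (less u)
    show ?case
    proof (cases "u = 0")
      case False
      then have u: "0 < u" "u - N < u" "below u v" using N_pos less.prems by auto
      have "u - N = 0 \<or> below (u - N) v"
        using u lev_parent[of u] col_parent[of u] by (auto simp: below_def)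
      then have IH: "sum w (path_edges (col_path (u - N))) = \<phi> (u - N)" using less.IH u by blast
      have "path_edges (col_path u) = insert {u, u - N} (path_edges (col_path (u - N)))"
        using col_path_rec[OF u(1)] col_path_facts[of "u - N"] by (simp add: path_edges_Cons)
      moreover have "{u, u - N} \<notin> path_edges (col_path (u - N))"
        using vertical_in_col_path[OF u(1)] below_le[of u "u - N"] u by auto
      ultimately show ?thesis using IH own[OF u(3)] w_vert[OF u(1)] by simp
    qed (simp add: col_path_0 \<phi>0)
  qed
  have "v = 0 \<or> below v v" using below_refl by blast
  then have own_cost: "sum w (path_edges (col_path v)) = \<phi> v" by (rule tight)
  have "v < n" using v n_pos by auto
  then have "strategy G a (col_path v)"
    using is_path_col_path v by (simp add: strategy_def)
  moreover have "\<phi> v \<le> sum w (path_edges q)" if "strategy G a q" for q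
  proof -
    have "is_path {..<n} E v q 0" using that v by (simp add: strategy_def)
    then have "\<phi> v - \<phi> 0 \<le> sum w (path_edges q)"
      by (rule potential_le_path_weight) (rule lip)
    then show ?thesis using \<phi>0 by simp
  qed
  ultimately show ?thesis unfolding best_response_def sc own_cost by blast
qed

text \<open>The potential below is \<open>0\<close>, \<open>\<mu>\<close> or the cost \<open>w\<close> of the agent's first edge, up to the
  negligible cost of the free part of her column: \<open>0\<close> on the clusters met by the free part, \<open>w\<close>
  on her own cluster, \<open>\<mu>\<close> elsewhere. As \<open>w \<le> 2 * \<mu>\<close> and no edge joins a cluster of the first kind
  to the one of the second outside her column, it drops by at most \<open>\<mu>\<close> along foreign edges.\<close>

lemma best_response_with_helpers:
  fixes t :: nat
  defines "\<mu> \<equiv> 1 / (real t + 2)"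
  assumes A: "finite A" "a \<notin> A" and v: "a mod n = v" "0 < v"
    and off: "\<And>u. 0 < u \<Longrightarrow> col u \<noteq> col v \<Longrightarrow> ld A u \<le> t + 1"
    and above: "\<And>u. col u = col v \<Longrightarrow> lev v < lev u \<Longrightarrow> ld A u \<le> t"
    and at: "t \<le> ld A v"
    and cheap: "(\<Sum>u | below u (v - N). 1 / (real (ld A u) + 1)) \<le> min \<delta> \<mu>"
  shows "best_response G (st A) a (col_path v)"
proof -
  define c where "c u = 1 / (real (ld A u) + 1)" for u
  define S where "S u = (\<Sum>x | below x u. c x)" for u
  define w where "w = c v"
  define low where "low u \<longleftrightarrow> (\<exists>x. below x v \<and> x \<noteq> v \<and> clu u = clu x)" for u
  define \<phi> where "\<phi> u = (if u = 0 then 0 else if below u v then S u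
    else if clu u = clu v then w else if low u then 0 else \<mu>)" for u
  have S_rec: "S u = c u + S (u - N)" if "0 < u" for u
  proof -
    have "{x. below x u} = insert u {x. below x (u - N)}"
      using below_iff_parent[OF that] by auto
    moreover have "\<not> below u (u - N)" using below_le[of u "u - N"] that N_pos by auto
    ultimately show ?thesis unfolding S_def using finite_below by simp
  qed
  have S_nonneg: "0 \<le> S u" for u unfolding S_def c_def by (intro sum_nonneg) simp
  have \<mu>_pos: "0 < \<mu>" by (simp add: \<mu>_def)
  have cheap': "S (v - N) \<le> \<delta>" "S (v - N) \<le> \<mu>" using cheap unfolding S_def c_def by auto
  have w: "0 \<le> w" "w \<le> 1 / (real t + 1)"
    unfolding w_def c_def using at by (auto intro!: divide_left_mono)
  \<comment> \<open>The second inequality is the numerical core: two foreign edges of load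
    \<open>t + 1\<close> are no cheaper than one own edge of load \<open>t\<close>.\<close>
  have mu1: "\<mu> \<le> 1 / (real t + 1)" "1 / (real t + 1) \<le> 2 * \<mu>"
    unfolding \<mu>_def by (auto simp: field_simps)
  have c_off: "\<mu> \<le> c u" if "0 < u" "col u \<noteq> col v" for u
    unfolding \<mu>_def c_def using off[OF that] by (intro divide_left_mono) auto
  have c_above: "1 / (real t + 1) \<le> c u" if "col u = col v" "lev v < lev u" for u
    unfolding c_def using above[OF that] by (intro divide_left_mono) auto
  have lev_v: "lev v = Suc (lev (v - N))" using lev_parent v by simp
  have below_parent: "u - N = 0 \<or> below (u - N) v" if "below u v" for u
    using that lev_parent[of u] col_parent[of u] by (auto simp: below_def)
  have low_lev: "lev u < lev v" if "low u" for u
    using that lev_clu lev_col_inj[of _ v] v unfolding low_def below_def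
    by (metis le_neq_implies_less)
  have \<phi>_v: "\<phi> v = w + S (v - N)"
    using v below_refl S_rec[of v] by (simp add: \<phi>_def w_def)
  have own: "\<phi> u - \<phi> (u - N) = c u" if "below u v" for u
  proof -
    have "\<phi> u = S u" using that below_pos[OF that] by (simp add: \<phi>_def)
    moreover have "\<phi> (u - N) = S (u - N)"
      using below_parent[OF that] by (auto simp: \<phi>_def S_def dest: below_pos)
    ultimately show ?thesis using S_rec[of u] below_pos[OF that] by simp
  qed
  have off_values: "\<phi> u = (if clu u = clu v then w else if low u then 0 else \<mu>)"
    if "0 < u" "\<not> below u v" for u
    using that by (simp add: \<phi>_def)
  have above_value: "\<phi> u = \<mu>" if "col u = col v" "lev v < lev u" for u
  proof -
    have "\<not> below u v" "0 < u" using that by (auto simp: below_def intro: gr0I)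
    moreover have "clu u \<noteq> clu v" "\<not> low u" using that lev_clu[of u v] low_lev[of u] by auto
    ultimately show ?thesis using off_values by simp
  qed
  have vert: "\<bar>\<phi> u - \<phi> (u - N)\<bar> \<le> c u" if u: "0 < u" for u
  proof -
    consider "below u v" | "col u = col v" "lev v < lev u" | "col u \<noteq> col v"
      using u unfolding below_def by (meson not_le)
    then show ?thesis
    proof cases
      case 1
      then show ?thesis using own by (simp add: c_def)
    next
      case 2
      have lu: "lev u = Suc (lev (u - N))" using u lev_parent by simp
      then have "0 < lev (u - N)" using 2 lev_v by linarith
      then have pos: "0 < u - N" by (metis gr0I lev_0 less_irrefl)
      have cu: "col (u - N) = col v" using pos 2 col_parent by simp
      show ?thesis
      proof (cases "u - N = v")
        \<comment> \<open>For the edge just above \<open>v\<close> the value falls from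
          \<open>w + S (v - N)\<close> to \<mu> or rises to it. Here the free part must cost at most
          \<mu>, so that the difference stays within \<open>1 / (t + 1)\<close>.\<close>
        case True
        then show ?thesis
          using above_value[OF 2] \<phi>_v c_above[OF 2] w mu1 cheap' S_nonneg[of "v - N"] \<mu>_pos
          by (simp add: abs_if)
      next
        case False
        then have "lev v < lev (u - N)"
          using lev_col_inj[OF pos v(2)] cu lu 2 by linarith
        then show ?thesis using above_value[OF 2] above_value[OF cu] by (simp add: c_def)
      qed
    next
      case 3
      have \<phi>u: "\<phi> u = (if clu u = clu v then w else if low u then 0 else \<mu>)"
        using 3 off_values u by (simp add: below_def)
      have cu: "col (u - N) \<noteq> col v" if "0 < u - N" using 3 that col_parent by simp
      then have \<phi>u': "\<phi> (u - N) = (if clu (u - N) = clu v then w else if low (u - N) then 0 else \<mu>)"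
        if "0 < u - N" using that off_values by (simp add: below_def)
      have c: "\<mu> \<le> c u" using c_off u 3 by blast
      consider "clu u = clu v" | "clu u \<noteq> clu v" "low u" | "clu u \<noteq> clu v" "\<not> low u" by blast
      then show ?thesis
      proof cases
        case 1
        have "N < u" using 1 3 clu_level_1[of u v] by (cases "N < u") auto
        have lu: "lev (u - N) = lev (v - N)"
          using 1 lev_clu[of u v] lev_parent[OF u] lev_v by simp
        \<comment> \<open>Otherwise the foreign column of \<open>u\<close> would be adjacent to the
          agent's column on two consecutive levels.\<close>
        have "\<not> low (u - N)"
        proof
          assume "low (u - N)"
          then obtain x where x: "below x v" "clu (u - N) = clu x" by (auto simp: low_def)
          then have "lev x = lev (v - N)" using lev_clu[OF x(2)] lu by simp
          moreover have "lev (v - N) \<noteq> 0" unfolding lu[symmetric] using \<open>N < u\<close> by simp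
          then have "0 < v - N" by (metis gr0I lev_0)
          ultimately have "x = v - N"
            using lev_col_inj[of x "v - N"] x(1) col_parent[of v] by (simp add: below_def)
          then show False using clu_consecutive[of u v] 1 3 x(2) by auto
        qed
        moreover have "clu (u - N) \<noteq> clu v" using lev_clu[of "u - N" v] lu lev_v by auto
        ultimately have "\<phi> (u - N) = \<mu>" using \<phi>u' \<open>N < u\<close> by simp
        then show ?thesis using 1 \<phi>u c w mu1 \<mu>_pos by (simp add: abs_if)
      next
        case 2
        then obtain x where x: "below x v" "clu u = clu x" by (auto simp: low_def)
        have "N < u" using x 3 clu_level_1[of u x] by (cases "N < u") (auto simp: below_def)
        have "lev (u - N) < lev v" using low_lev[OF 2(2)] lev_parent[OF u] by simp
        then have "clu (u - N) \<noteq> clu v" using lev_clu[of "u - N" v] by auto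
        then show ?thesis using 2 \<phi>u \<phi>u' \<open>N < u\<close> c \<mu>_pos by (simp add: abs_if)
      next
        case 3
        \<comment> \<open>The lower end may have a value of any kind; 0 \<le> w \<le> 2\<mu> keeps
          each of them within \<mu> of \<mu>.\<close>
        have "\<phi> (u - N) \<in> {0, w, \<mu>}"
          using \<phi>u' by (cases "u - N = 0") (auto simp: \<phi>_def)
        then show ?thesis using 3 \<phi>u c w mu1 \<mu>_pos by (auto simp: abs_if)
      qed
    qed
  qed
  have own_class: "\<phi> y = (if x = v then w else 0)"
    if "below x v" "x \<noteq> y" "clu x = clu y" for x y
  proof -
    have "col y \<noteq> col x" using clu_col_inj[of x y] that by auto
    then have "\<not> below y v" using that(1) by (simp add: below_def)
    moreover have "0 < y" using lev_clu[OF that(3)] below_pos[OF that(1)] by (auto intro: gr0I)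
    moreover have "low y" "clu y \<noteq> clu v" if "x \<noteq> v"
    proof -
      show "low y" using \<open>below x v\<close> that \<open>clu x = clu y\<close> unfolding low_def by metis
      then show "clu y \<noteq> clu v" using low_lev[of y] lev_clu[of y v] by auto
    qed
    ultimately show ?thesis using off_values that(3) by auto
  qed
  have S_le: "S x \<le> S (v - N)" if "below x v" "x \<noteq> v" for x
  proof -
    have "below x (v - N)" using that below_iff_parent v by blast
    then have "{u. below u x} \<subseteq> {u. below u (v - N)}" by (auto simp: below_def)
    then show ?thesis unfolding S_def by (intro sum_mono2 finite_below) (simp_all add: c_def)
  qed
  \<comment> \<open>Within a cluster \<phi> is constant except on the agent's own column, where it
    is larger by the cost of a piece of the free part, hence by at most \<delta>.\<close>
  have hor: "\<phi> x - \<phi> y \<le> \<delta>" if "x \<noteq> y" "clu x = clu y" for x y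
  proof -
    have pos: "0 < x" "0 < y"
      using that lev_clu[of x y] lev_eq_0_iff[of x] lev_eq_0_iff[of y]
      by (cases "x = 0"; cases "y = 0"; simp)+
    consider "below x v" | "below y v" | "\<not> below x v" "\<not> below y v" by blast
    then show ?thesis
    proof cases
      case 1
      then have y: "\<phi> y = (if x = v then w else 0)" using own_class that by blast
      show ?thesis
      proof (cases "x = v")
        case False
        then have "\<phi> x = S x" using 1 pos by (simp add: \<phi>_def)
        then show ?thesis using y False S_le[OF 1 False] cheap' by simp
      qed (use y \<phi>_v cheap' in simp)
    next
      case 2
      then have x: "\<phi> x = (if y = v then w else 0)" using own_class[of y x] that by simp
      show ?thesis
      proof (cases "y = v")
        case False
        then have "\<phi> y = S y" using 2 pos by (simp add: \<phi>_def)
        then show ?thesis using x False S_nonneg[of y] \<delta>_pos by simp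
      qed (use x \<phi>_v S_nonneg[of "v - N"] \<delta>_pos in simp)
    next
      case 3
      then have "\<phi> x = \<phi> y" using off_values pos that(2) by (simp add: low_def)
      then show ?thesis using \<delta>_pos by simp
    qed
  qed
  show ?thesis
    by (rule best_response_if_potential[OF A v(1), of \<phi>])
      (use vert hor own in \<open>simp_all add: c_def \<phi>_def\<close>)
qed

subsection \<open>Reachable states\<close>

definition reach :: "nat set \<Rightarrow> bool" where
  "reach A \<longleftrightarrow> finite A \<and> (event G)\<^sup>*\<^sup>* Map.empty (st A)"

lemma reach_empty: "reach {}"
proof -
  have "st {} = Map.empty" by (rule ext) (simp add: st_def)
  then show ?thesis by (simp add: reach_def)
qed

lemma reach_insert:
  assumes "reach A" "a \<notin> A" "best_response G (st A) a (col_path (a mod n))"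
  shows "reach (insert a A)"
proof -
  have "arrival G (st A) (insert a {}) ((st A)(a \<mapsto> col_path (a mod n)))"
    using assms by (intro arrival.join arrival.empty) auto
  then have "event G (st A) (st (insert a A))"
    unfolding event_def st_insert by blast
  then show ?thesis using assms(1) by (auto simp: reach_def)
qed

text \<open>A single departure suffices, since those who stay keep their columns.\<close>

lemma reach_subset:
  assumes "reach B" "A \<subseteq> B"
  shows "reach A"
proof -
  have "departure (st B) (B - A) (st A)"
    using assms(2) by (auto simp: departure_def st_def restrict_map_def intro!: ext)
  then have "event G (st B) (st A)" unfolding event_def by blast
  then show ?thesis using assms finite_subset by (auto simp: reach_def)
qed

lemma fresh_agent:
  assumes "finite A" "v < n"
  shows "\<exists>a. a \<notin> A \<and> a mod n = v"
proof -
  have "inj (\<lambda>k. v + n * k)" using n_pos by (auto simp: inj_def)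
  then have "infinite (range (\<lambda>k. v + n * k))" using finite_imageD by blast
  then obtain a where "a \<in> range (\<lambda>k. v + n * k)" "a \<notin> A"
    using assms(1) by (meson finite_subset subsetI)
  then show ?thesis using assms(2) by auto
qed

section \<open>Counting agents at the tops of the columns\<close>

definition tops :: "nat set" where
  "tops = {v. 0 < v \<and> lev v = K}"

lemma lev_le_iff: "0 < h \<Longrightarrow> lev v \<le> h \<longleftrightarrow> v \<le> h * N"
proof -
  assume h: "0 < h"
  have "(v - 1) div N < h \<longleftrightarrow> v - 1 < h * N"
    using N_pos by (simp add: less_mult_imp_div_less div_less_iff_less_mult)
  then show ?thesis using h N_pos by (auto simp: lev_def)
qed

lemma K_N_less_n: "K * N < n"
  using n_gt by (simp add: N_def power3_eq_cube)

lemma top_unique: "p \<in> tops \<Longrightarrow> q \<in> tops \<Longrightarrow> col p = col q \<Longrightarrow> p = q"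
  using lev_col_inj[of p q] unfolding tops_def by simp

lemma tops_less_n: "p \<in> tops \<Longrightarrow> p < n"
  using lev_le_iff[of K p] K_pos K_N_less_n by (simp add: tops_def)

lemma finite_tops: "finite tops"
  by (rule finite_subset[of _ "{..<n}"]) (auto dest: tops_less_n)

definition cnt :: "nat set \<Rightarrow> nat \<Rightarrow> nat" where
  "cnt A p = card {a \<in> A. a mod n = p}"

lemma cnt_insert:
  assumes "finite A" "a \<notin> A"
  shows "cnt (insert a A) p = cnt A p + (if a mod n = p then 1 else 0)"
proof (cases "a mod n = p")
  case True
  then have "{b \<in> insert a A. b mod n = p} = insert a {b \<in> A. b mod n = p}" by auto
  then show ?thesis using assms True by (simp add: cnt_def)
next
  case False
  then have "{b \<in> insert a A. b mod n = p} = {b \<in> A. b mod n = p}" by auto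
  then show ?thesis using False by (simp add: cnt_def)
qed

text \<open>Distinct tops lie in distinct columns, so with agents at tops only, the load is the same
  on all edges of a column up to its top.\<close>

lemma ld_eq_cnt:
  assumes "\<forall>a\<in>A. a mod n \<in> tops" "p \<in> tops" "below u p"
  shows "ld A u = cnt A p"
proof -
  have "below u x \<longleftrightarrow> x = p" if "x \<in> tops" for x
    using assms(2,3) that top_unique[of x p] by (metis below_def)
  then have "below u (a mod n) \<longleftrightarrow> a mod n = p" if "a \<in> A" for a
    using assms(1) that by blast
  then have "{a \<in> A. below u (a mod n)} = {a \<in> A. a mod n = p}" by auto
  then show ?thesis by (simp add: ld_def cnt_def)
qed

lemma ld_above_tops:
  assumes "\<forall>a\<in>A. a mod n \<in> tops" "K < lev u"
  shows "ld A u = 0"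
proof -
  have "{a \<in> A. below u (a mod n)} = {}" using assms by (auto simp: below_def tops_def)
  then show ?thesis unfolding ld_def by (metis card.empty)
qed

lemma col_less: "col v < N"
  using N_pos by (simp add: col_def)

text \<open>The inverse of \<open>lev\<close> and \<open>col\<close>; here \<open>h\<close> is one
  less than the level.\<close>

definition vtx :: "nat \<Rightarrow> nat \<Rightarrow> nat" where
  "vtx h i = Suc (h * N + i)"

lemma lev_vtx: "i < N \<Longrightarrow> lev (vtx h i) = Suc h" and col_vtx: "i < N \<Longrightarrow> col (vtx h i) = i"
  by (simp_all add: vtx_def lev_def col_def)

lemma top_of_column:
  assumes "0 < u" "lev u \<le> K"
  shows "\<exists>p\<in>tops. below u p"
proof -
  have "vtx (K - 1) (col u) \<in> tops"
    using lev_vtx[OF col_less] K_pos by (simp add: tops_def vtx_def)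
  moreover have "below u (vtx (K - 1) (col u))"
    using assms lev_vtx[OF col_less] col_vtx[OF col_less] K_pos by (simp add: below_def)
  ultimately show ?thesis by blast
qed

lemma ld_le_if_cnt_le:
  assumes "\<forall>a\<in>A. a mod n \<in> tops" "0 < u" "\<forall>p\<in>tops. below u p \<longrightarrow> cnt A p \<le> m"
  shows "ld A u \<le> m"
proof (cases "lev u \<le> K")
  case True
  then obtain p where "p \<in> tops" "below u p" using top_of_column assms(2) by blast
  then show ?thesis using ld_eq_cnt[OF assms(1)] assms(3) by auto
next
  case False
  then show ?thesis using ld_above_tops[OF assms(1)] by simp
qed

lemma card_below: "card {u. below u v} = lev v"
proof (induction v rule: less_induct)
  case (less v)
  show ?case
  proof (cases "v = 0")
    case False
    then have v: "0 < v" "v - N < v" using N_pos by auto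
    have "{u. below u v} = insert v {u. below u (v - N)}"
      using below_iff_parent[OF v(1)] by auto
    moreover have "\<not> below v (v - N)" using below_le[of v "v - N"] v by auto
    ultimately show ?thesis using less.IH[OF v(2)] finite_below lev_parent[OF v(1)] by simp
  qed simp
qed

section \<open>Raising the counts with helpers\<close>

text \<open>The bound \<open>t + 1\<close> admits columns that have already received their
  additional agent. The helpers climb the column of \<open>p\<close>, and the agent who stays
  arrives by the same step as they do.\<close>

lemma add_agent_at_top:
  assumes A: "reach A" "\<forall>a\<in>A. a mod n \<in> tops" and p: "p \<in> tops"
    and cnt_p: "cnt A p = t" and cnt_le: "\<forall>q\<in>tops. cnt A q \<le> t + 1"
  shows "\<exists>a. a \<notin> A \<and> a mod n = p \<and> reach (insert a A)"
proof -
  \<comment> \<open>The price allowed for the free part in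
    \<open>best_response_with_helpers\<close>; \<open>M\<close> is so large that \<open>K\<close>
    edges of load at least \<open>M\<close> stay within it.\<close>
  define \<eta> where "\<eta> = min \<delta> (1 / (real t + 2))"
  have pos: "0 < \<eta>" using \<delta>_pos by (simp add: \<eta>_def)
  obtain M :: nat where M: "real K / \<eta> \<le> real M" using real_arch_simple by blast
  have "real K \<le> real M * \<eta>" using M pos by (simp add: pos_divide_le_eq)
  also have "\<dots> \<le> (real M + 1) * \<eta>" using pos by (intro mult_right_mono) auto
  finally have M': "real K * (1 / (real M + 1)) \<le> \<eta>"
    by (simp add: pos_divide_le_eq mult.commute)
  \<comment> \<open>All helpers live at or below \<open>v\<close>, and every edge below the one
    leaving \<open>v\<close> downwards is already heavily used.\<close>
  define Inv where "Inv v B \<longleftrightarrow> reach B \<and> A \<subseteq> B \<and> (\<forall>b\<in>B - A. below (b mod n) v)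
    \<and> (\<forall>u. below u (v - N) \<longrightarrow> M \<le> ld B u)" for v B
  have add: "\<exists>a. a \<notin> B \<and> a mod n = v \<and> Inv v (insert a B)" if B: "Inv v B" and v: "below v p" for v B
  proof -
    have vn: "v < n" "0 < v" using below_le[OF v] tops_less_n[OF p] below_pos[OF v] by auto
    have fin: "finite B" using B by (simp add: Inv_def reach_def)
    obtain a where a: "a \<notin> B" "a mod n = v" using fresh_agent[OF fin vn(1)] by blast
    \<comment> \<open>Helpers use only edges of the column at or below \<open>v\<close>, so all
      other loads are those of \<open>A\<close>.\<close>
    have same: "ld B u = ld A u" if "\<not> below u v" for u
    proof -
      have "{b \<in> B. below u (b mod n)} = {b \<in> A. below u (b mod n)}"
        using B that below_trans unfolding Inv_def by blast
      then show ?thesis by (simp add: ld_def)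
    qed
    have lev_v: "lev v \<le> K" "col v = col p" using v p by (auto simp: below_def tops_def)
    have "best_response G (st B) a (col_path v)"
    proof (rule best_response_with_helpers[OF fin a vn(2), of t])
      fix u assume u: "0 < u" "col u \<noteq> col v"
      then have "ld B u = ld A u" by (intro same) (simp add: below_def)
      then show "ld B u \<le> t + 1" using ld_le_if_cnt_le[OF A(2) u(1)] cnt_le by simp
    next
      fix u assume u: "col u = col v" "lev v < lev u"
      then have "ld B u = ld A u" by (intro same) (simp add: below_def)
      moreover have "0 < u" using u by (auto intro: gr0I)
      moreover have "\<forall>q\<in>tops. below u q \<longrightarrow> cnt A q \<le> t"
      proof (intro ballI impI)
        fix q assume "q \<in> tops" "below u q"
        then have "q = p"
          using top_unique p u(1) lev_v(2) by (metis below_def)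
        then show "cnt A q \<le> t" using cnt_p by simp
      qed
      ultimately show "ld B u \<le> t" using ld_le_if_cnt_le[OF A(2)] by simp
    next
      have "ld A v = t" using ld_eq_cnt[OF A(2) p v] cnt_p by simp
      then show "t \<le> ld B v" using ld_mono[OF fin, of A v] B by (simp add: Inv_def)
    next
      have "(\<Sum>u | below u (v - N). 1 / (real (ld B u) + 1))
          \<le> (\<Sum>u | below u (v - N). 1 / (real M + 1))"
        using B by (intro sum_mono divide_left_mono) (auto simp: Inv_def)
      also have "\<dots> = real (lev (v - N)) * (1 / (real M + 1))" by (simp add: card_below)
      also have "\<dots> \<le> real K * (1 / (real M + 1))"
        using lev_parent[OF vn(2)] lev_v by (intro mult_right_mono) auto
      also note M'
      finally show "(\<Sum>u | below u (v - N). 1 / (real (ld B u) + 1)) \<le> min \<delta> (1 / (real t + 2))"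
        unfolding \<eta>_def .
    qed
    then have "reach (insert a B)" using reach_insert[of B a] B a by (simp add: Inv_def)
    moreover have "ld B u \<le> ld (insert a B) u" for u by (rule ld_mono) (use fin in auto)
    ultimately have "Inv v (insert a B)"
      using B a below_refl[OF vn(2)] unfolding Inv_def by (auto intro: order_trans)
    then show ?thesis using a by blast
  qed
  \<comment> \<open>Enough arrivals at \<open>v\<close> make its edge cheap as well;
    \<open>ex\<close> then moves on to the next level.\<close>
  have many: "\<exists>B. Inv v B \<and> m \<le> ld B v" if "\<exists>B. Inv v B" and v: "below v p" for v m
  proof (induction m)
    case 0
    then show ?case using that by auto
  next
    case (Suc m)
    then obtain B where B: "Inv v B" "m \<le> ld B v" by blast
    obtain a where a: "a \<notin> B" "a mod n = v" "Inv v (insert a B)" using add[OF B(1) v] by blast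
    have "finite B" using B by (simp add: Inv_def reach_def)
    then have "Suc m \<le> ld (insert a B) v"
      using B a ld_insert[of B a v] below_refl below_pos[OF v] by simp
    then show ?case using a by blast
  qed
  have ex: "\<exists>B. Inv v B" if "below v p" for v
    using that
  proof (induction v rule: less_induct)
    case (less v)
    have v: "0 < v" "v - N < v" using below_pos[OF less.prems] N_pos by auto
    show ?case
    proof (cases "v - N = 0")
      case True
      then show ?thesis using A(1) by (auto simp: Inv_def)
    next
      case False
      then have "below (v - N) p"
        using less.prems lev_parent[OF v(1)] col_parent[of v] by (simp add: below_def)
      then obtain B where B: "Inv (v - N) B" "M \<le> ld B (v - N)"
        using many less.IH[OF v(2)] by blast
      have "below u (v - N) \<Longrightarrow> M \<le> ld B u" for u
        using B below_iff_parent[of "v - N" u] False by (auto simp: Inv_def)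
      moreover have "below u (v - N) \<Longrightarrow> below u v" for u using below_iff_parent[OF v(1)] by blast
      ultimately have "Inv v B" using B unfolding Inv_def by blast
      then show ?thesis by blast
    qed
  qed
  have "below p p" using p below_refl by (simp add: tops_def)
  then obtain B where "Inv p B" using ex by blast
  \<comment> \<open>This last arrival, at the top itself, stays while all members of
    \<open>B - A\<close> depart.\<close>
  then obtain a where "a \<notin> B" "a mod n = p" "Inv p (insert a B)"
    using add \<open>below p p\<close> by blast
  then show ?thesis
    using reach_subset[of "insert a B" "insert a A"] \<open>Inv p B\<close> unfolding Inv_def by blast
qed

text \<open>One round raises the tops one after another, \<open>Q\<close> being those already
  served. All counts lie between \<open>t\<close> and \<open>t + 1\<close> during the round, as
  adding an agent requires.\<close>

lemma reach_uniform: "\<exists>A. reach A \<and> (\<forall>a\<in>A. a mod n \<in> tops) \<and> (\<forall>p\<in>tops. cnt A p = t)"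
proof (induction t)
  case 0
  then show ?case using reach_empty by (intro exI[of _ "{}"]) (simp add: cnt_def)
next
  case (Suc t)
  have "\<exists>A. reach A \<and> (\<forall>a\<in>A. a mod n \<in> tops)
      \<and> (\<forall>p\<in>tops. cnt A p = (if p \<in> Q then Suc t else t))" if "Q \<subseteq> tops" for Q
    using finite_subset[OF that finite_tops] that
  proof (induction Q rule: finite_induct)
    case empty
    then show ?case using Suc by simp
  next
    case (insert q Q)
    then obtain A where A: "reach A" "\<forall>a\<in>A. a mod n \<in> tops"
        "\<forall>p\<in>tops. cnt A p = (if p \<in> Q then Suc t else t)" by auto
    have "q \<in> tops" "cnt A q = t" "\<forall>p\<in>tops. cnt A p \<le> t + 1"
      using A(3) insert.hyps insert.prems by auto
    then obtain a where a: "a \<notin> A" "a mod n = q" "reach (insert a A)"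
      using add_agent_at_top[OF A(1,2)] by blast
    have "finite A" using A(1) by (simp add: reach_def)
    then have "\<forall>p\<in>tops. cnt (insert a A) p = (if p \<in> insert q Q then Suc t else t)"
      using A(3) a insert.hyps cnt_insert[of A a] by auto
    then show ?case using a A \<open>q \<in> tops\<close> by (intro exI[of _ "insert a A"]) auto
  qed
  from this[OF order_refl] show ?case by auto
qed

section \<open>The final equilibrium and its social cost\<close>

text \<open>Deviating amounts to leaving and arriving again by another path, so it suffices that her
  column is a best response for each agent once she is removed.\<close>

lemma nash_if_uniform:
  assumes A: "finite A" "\<forall>a\<in>A. a mod n \<in> tops" "\<forall>p\<in>tops. cnt A p = n"
  shows "nash_equilibrium G (st A)"
proof -
  have "best_response G (st (A - {a})) a (col_path (a mod n))" if a: "a \<in> A" for a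
  proof -
    define p where "p = a mod n"
    \<comment> \<open>Height times the share she would pay per edge: her own column has
      \<open>n\<close> users including her, a foreign one \<open>n + 1\<close>. Above level
      \<open>K\<close> the potential stays constant.\<close>
    define \<phi> where "\<phi> u = real (min (lev u) K) / (if col u = col p then real n else real n + 1)" for u
    have p: "p \<in> tops" using A a by (simp add: p_def)
    let ?B = "A - {a}"
    have B: "finite ?B" "a \<notin> ?B" "\<forall>a\<in>?B. a mod n \<in> tops" using A by auto
    have cnt_B: "cnt ?B q + (if p = q then 1 else 0) = n" if "q \<in> tops" for q
      using cnt_insert[OF B(1,2), of q] A(3) that a by (simp add: insert_absorb p_def)
    have ld_own: "real (ld ?B u) + 1 = real n" if "below u p" for u
      using ld_eq_cnt[OF B(3) p that] cnt_B[OF p] by auto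
    have ld_off: "ld ?B u \<le> n" if "0 < u" for u
      using ld_le_if_cnt_le[OF B(3) that, of n] cnt_B by fastforce
    show ?thesis
      unfolding p_def[symmetric]
    proof (rule best_response_if_potential[OF B(1,2) p_def[symmetric], of \<phi>])
      show "\<phi> 0 = 0" by (simp add: \<phi>_def)
    next
      fix u assume u: "below u p"
      have "lev u \<le> K" "col u = col p" "0 < u" using u p by (auto simp: below_def tops_def)
      then have "\<phi> u - \<phi> (u - N) = 1 / real n"
        using lev_parent[of u] col_parent[of u]
        by (cases "u \<le> N") (auto simp: \<phi>_def min_def diff_divide_distrib[symmetric])
      then show "\<phi> u - \<phi> (u - N) = 1 / (real (ld ?B u) + 1)" using ld_own[OF u] by simp
    next
      fix u :: nat assume u: "0 < u"
      define d where "d = (if col u = col p then real n else real n + 1)"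
      have d: "\<phi> u = real (min (lev u) K) / d" "\<phi> (u - N) = real (min (lev (u - N)) K) / d" "0 < d"
        using u col_parent[of u] n_pos by (cases "u \<le> N"; auto simp: \<phi>_def d_def)+
      show "\<bar>\<phi> u - \<phi> (u - N)\<bar> \<le> 1 / (real (ld ?B u) + 1)"
      proof (cases "lev u \<le> K")
        case True
        then have "\<phi> u - \<phi> (u - N) = 1 / d"
          using d lev_parent[OF u] by (simp add: min_def diff_divide_distrib[symmetric])
        moreover have "real (ld ?B u) + 1 \<le> d"
        proof (cases "col u = col p")
          case same: True
          then have "below u p" using u True p by (simp add: below_def tops_def)
          then show ?thesis using ld_own same by (simp add: d_def)
        next
          case False
          then show ?thesis using ld_off[OF u] by (simp add: d_def)
        qed
        ultimately show ?thesis using d by (simp add: divide_left_mono)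
      next
        case False
        then have "min (lev u) K = K" "min (lev (u - N)) K = K" using lev_parent[OF u] by simp_all
        then show ?thesis using d by simp
      qed
    next
      fix x y assume "clu x = clu y"
      then have l: "lev x = lev y" by (rule lev_clu)
      define m where "m = real (min (lev y) K)"
      have "K \<le> K * N" using N_pos by simp
      then have "K \<le> n" using K_N_less_n by linarith
      have m: "0 \<le> m" "m \<le> real n" "0 < real n"
        using \<open>K \<le> n\<close> n_pos by (auto simp: m_def)
      have "\<phi> x \<le> m / real n" "m / (real n + 1) \<le> \<phi> y"
        using m l by (auto simp: \<phi>_def m_def intro!: divide_left_mono)
      \<comment> \<open>The most that changing columns at height \<open>m\<close> can save; it is at
        most \<delta> because m \<le> n.\<close>
      moreover have "m / real n - m / (real n + 1) = m / (real n * (real n + 1))"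
        using m by (simp add: field_simps)
      moreover have "m / (real n + 1) / real n \<le> 1 / real n"
        using m by (intro divide_right_mono) simp_all
      then have "m / (real n * (real n + 1)) \<le> \<delta>" by (simp add: \<delta>_def mult.commute)
      ultimately show "\<phi> x - \<phi> y \<le> \<delta>" by linarith
    qed
  qed
  moreover have "(st A)(a \<mapsto> q) = (st (A - {a}))(a \<mapsto> q)" for a q
    by (rule ext) (simp add: st_def)
  moreover have "st A = (st (A - {a}))(a \<mapsto> col_path (a mod n))" if "a \<in> A" for a
    using that by (intro ext) (simp add: st_def)
  ultimately have "shared_cost G (st A) a \<le> shared_cost G ((st A)(a \<mapsto> q)) a"
    if "a \<in> A" "strategy G a q" for a q
    using that unfolding best_response_def by simp
  then show ?thesis unfolding nash_equilibrium_def dom_st by (meson not_le)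
qed

text \<open>Every top is inhabited, so the edges in use are exactly the \<open>K * N\<close>
  vertical edges up to level \<open>K\<close>, each of cost 1.\<close>

lemma social_cost_uniform:
  assumes A: "\<forall>a\<in>A. a mod n \<in> tops" "\<forall>p\<in>tops. cnt A p = n"
  shows "social_cost G (st A) = real K ^ 3"
proof -
  have "(\<Union>a\<in>A. path_edges (the (st A a))) = (\<lambda>u. {u, u - N}) ` {0<..K * N}" (is "?L = ?R")
  proof (intro equalityI subsetI)
    fix e assume "e \<in> ?L"
    then obtain a where a: "a \<in> A" "e \<in> path_edges (col_path (a mod n))" by (auto simp: st_def)
    then obtain u where u: "below u (a mod n)" "e = {u, u - N}" using col_path_facts by blast
    then have "lev u \<le> K" "0 < u" using A a by (auto simp: below_def tops_def)
    then show "e \<in> ?R" using u lev_le_iff[OF K_pos] by auto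
  next
    fix e assume "e \<in> ?R"
    then obtain u where u: "0 < u" "u \<le> K * N" "e = {u, u - N}" by auto
    then obtain p where p: "p \<in> tops" "below u p" using top_of_column lev_le_iff[OF K_pos] by blast
    then have "cnt A p \<noteq> 0" using A n_pos by simp
    then obtain a where "a \<in> A" "a mod n = p" unfolding cnt_def
      by (metis (mono_tags, lifting) card.empty empty_Collect_eq)
    then show "e \<in> ?L" using u p vertical_in_col_path[OF u(1)] by (auto simp: st_def)
  qed
  moreover have "inj_on (\<lambda>u. {u, u - N}) {0<..K * N}"
    using vertical_eq_iff by (auto simp: inj_on_def)
  ultimately have "social_cost G (st A) = (\<Sum>u\<in>{0<..K * N}. cost G {u, u - N})"
    by (simp add: social_cost_def sum.reindex)
  also have "\<dots> = (\<Sum>u\<in>{0<..K * N}. 1)" by (intro sum.cong) (auto simp: cost_vertical)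
  finally show ?thesis by (simp add: N_def power3_eq_cube)
qed

subsection \<open>The minimum spanning tree\<close>

text \<open>Above level 1, the distance from \<open>v\<close> to the representative of its cluster,
  the member with the smallest column. On even levels this is the multiple of \<open>K\<close> in
  the block of \<open>v\<close>, on odd levels the remainder of its column modulo
  \<open>K\<close>.\<close>

definition rep_dist :: "nat \<Rightarrow> nat" where
  "rep_dist v = (if even (lev v) then col v mod K else K * (col v div K))"

text \<open>Representatives and level 1 hang from the level below by a unit edge, all others from
  their representative by a short edge.\<close>

definition tree_parent :: "nat \<Rightarrow> nat" where
  "tree_parent v = (if v \<le> N \<or> rep_dist v = 0 then v - N else v - rep_dist v)"

lemma rep_dist_le: "rep_dist v \<le> col v"
  by (simp add: rep_dist_def)

lemma clu_rep:
  assumes "N < v"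
  shows "clu (v - rep_dist v) = clu v"
proof -
  have v: "0 < v" using assms by simp
  have "v - rep_dist v = vtx (lev v - 1) (col v - rep_dist v)"
    using vertex_eq[OF v] rep_dist_le[of v] unfolding vtx_def by linarith
  moreover have "col v - rep_dist v < N" using col_less[of v] by simp
  moreover have "lev v = Suc (lev (v - N))" "lev (v - N) \<noteq> 0"
    using lev_parent[OF v] assms by simp_all
  ultimately have "lev (v - rep_dist v) = lev v" "col (v - rep_dist v) = col v - rep_dist v"
      "\<not> lev v \<le> 1"
    by (simp_all add: lev_vtx col_vtx)
  moreover have "(col v - col v mod K) div K = col v div K"
    using K_pos by (simp add: minus_mod_eq_mult_div)
  moreover have "(col v - K * (col v div K)) mod K = col v mod K"
    by (simp add: minus_mult_div_eq_mod)
  ultimately show ?thesis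
    by (cases "even (lev v)") (simp_all add: clu_def rep_dist_def)
qed

text \<open>Each level has at most \<open>K\<close> representatives, and \<open>n\<close> is at most
  \<open>8 * K * N\<close>, which leaves at most \<open>8 * K\<close> levels above the root.\<close>

lemma card_reps:
  assumes "n \<le> (K + 1) ^ 3"
  shows "card {v. N < v \<and> v < n \<and> rep_dist v = 0} \<le> 9 * N" (is "card ?R \<le> _")
proof -
  \<comment> \<open>Encodes a representative by its level and a number below \<open>K\<close>: on
    odd levels the column itself is already below \<open>K\<close>.\<close>
  define g where "g v = (lev v, if even (lev v) then col v div K else col v)" for v
  have col_eq: "K * (col v div K) = col v" if "v \<in> ?R" "even (lev v)" for v
    using that mult_div_mod_eq[of K "col v"] by (simp add: rep_dist_def)
  have "inj_on g ?R"
  proof (rule inj_onI)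
    fix u v assume uv: "u \<in> ?R" "v \<in> ?R" "g u = g v"
    then have "lev u = lev v" by (simp add: g_def)
    have "col u = col v"
    proof (cases "even (lev v)")
      case True
      then have "even (lev u)" using \<open>lev u = lev v\<close> by simp
      with True have "col u div K = col v div K" using uv(3) by (simp add: g_def)
      with \<open>even (lev u)\<close>
      show ?thesis using col_eq[OF uv(1)] col_eq[OF uv(2) True] by metis
    next
      case False
      then have "odd (lev u)" using \<open>lev u = lev v\<close> by simp
      with False show ?thesis using uv(3) by (simp add: g_def)
    qed
    moreover have "0 < u" "0 < v" using uv(1,2) by auto
    ultimately show "u = v" using lev_col_inj \<open>lev u = lev v\<close> by blast
  qed
  moreover have "g ` ?R \<subseteq> {..8 * K} \<times> {..<K}"
  proof
    fix z assume "z \<in> g ` ?R"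
    then obtain v where v: "v \<in> ?R" "z = g v" by blast
    have "(K + 1) ^ 3 \<le> (2 * K) ^ 3" using K_pos by (intro power_mono) auto
    also have "\<dots> = 8 * K * N" by (simp add: N_def power3_eq_cube)
    finally have "v \<le> 8 * K * N" using v assms by simp
    then have "lev v \<le> 8 * K" using lev_le_iff K_pos by simp
    moreover have "col v div K < K"
      using col_less[of v] K_pos by (simp add: N_def div_less_iff_less_mult)
    moreover have "col v < K" if "odd (lev v)"
      using v that K_pos by (simp add: rep_dist_def div_eq_0_iff)
    ultimately show "z \<in> {..8 * K} \<times> {..<K}" using v by (auto simp: g_def)
  qed
  ultimately have "card ?R \<le> card ({..8 * K} \<times> {..<K})"
    by (meson card_inj_on_le finite_SigmaI finite_atMost finite_lessThan)
  \<comment> \<open>The extra \<open>K\<close> stems from level 0, which the range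
    \<open>{..8 * K}\<close> includes.\<close>
  also have "\<dots> = 8 * N + K" by (simp add: N_def)
  also have "\<dots> \<le> 9 * N" using K_pos by (simp add: N_def)
  finally show ?thesis .
qed

lemma spanning_tree_reps:
  "spanning_tree {..<n} E ((\<lambda>v. {v, tree_parent v}) ` {0<..<n})"
proof (rule spanning_tree_if_parent)
  fix v assume v: "0 < v" "v < n"
  show "tree_parent v < v" using v N_pos by (auto simp: tree_parent_def)
  show "{v, tree_parent v} \<in> E"
  proof (cases "v \<le> N \<or> rep_dist v = 0")
    case True
    then show ?thesis using v vertical_in_E by (simp add: tree_parent_def)
  next
    case False
    then have "clu v = clu (v - rep_dist v)" "v \<noteq> v - rep_dist v" using clu_rep[of v] v by auto
    moreover have "v - rep_dist v < n" using v by simp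
    ultimately show ?thesis using v False unfolding tree_parent_def E_def by auto
  qed
qed

lemma finite_spanning_trees: "finite {T. spanning_tree {..<n} E T}"
  by (rule finite_subset[of _ "Pow E"]) (auto simp: spanning_tree_def finite_E)

text \<open>Every vertex is charged for the edge to its parent. The short edges contribute at most
  1, level 1 at most \<open>N\<close> and the higher representatives at most
  \<open>9 * N\<close>.\<close>

lemma mst_cost_le:
  assumes "n \<le> (K + 1) ^ 3"
  shows "mst_cost G \<le> 11 * real K ^ 2"
proof -
  let ?T = "(\<lambda>v. {v, tree_parent v}) ` {0<..<n}"
  define R where "R = {v. N < v \<and> v < n \<and> rep_dist v = 0}"
  have cost_le: "cost G {v, tree_parent v} \<le> \<delta> + (of_bool (v \<le> N) + of_bool (v \<in> R))"
    if "v \<in> {0<..<n}" for v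
  proof (cases "v \<le> N \<or> rep_dist v = 0")
    case True
    then have "cost G {v, tree_parent v} = 1"
      using that cost_vertical by (simp add: tree_parent_def)
    then show ?thesis using True that \<delta>_pos by (auto simp: R_def)
  next
    case False
    then have "cost G {v, tree_parent v} = \<delta>"
      using clu_rep[of v] cost_horizontal[of v "v - rep_dist v"] by (simp add: tree_parent_def)
    then show ?thesis by simp
  qed
  have "mst_cost G \<le> (\<Sum>e\<in>?T. cost G e)"
    unfolding mst_cost_def using spanning_tree_reps finite_spanning_trees by (intro Min_le) auto
  also have "\<dots> \<le> (\<Sum>v\<in>{0<..<n}. cost G {v, tree_parent v})"
    using sum_image_le[of "{0<..<n}" "cost G" "\<lambda>v. {v, tree_parent v}"] less_imp_le[OF cost_pos]
    by (simp add: o_def)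
  also have "\<dots> \<le> (\<Sum>v\<in>{0<..<n}. \<delta> + (of_bool (v \<le> N) + of_bool (v \<in> R)))"
    by (rule sum_mono) (rule cost_le)
  also have "\<dots> = real (n - 1) * \<delta> + real (card ({0<..<n} \<inter> {v. v \<le> N}))
      + real (card ({0<..<n} \<inter> R))"
    by (simp add: sum.distrib)
  also have "\<dots> \<le> 1 + real N + real (9 * N)"
  proof (intro add_mono)
    show "real (n - 1) * \<delta> \<le> 1" using n_pos by (simp add: \<delta>_def)
    have "card ({0<..<n} \<inter> {v. v \<le> N}) \<le> card {0<..N}" by (rule card_mono) auto
    then show "real (card ({0<..<n} \<inter> {v. v \<le> N})) \<le> real N" by simp
    have "card ({0<..<n} \<inter> R) \<le> card R" by (rule card_mono) (auto simp: R_def)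
    then show "real (card ({0<..<n} \<inter> R)) \<le> real (9 * N)"
      using card_reps[OF assms] unfolding R_def[symmetric] by linarith
  qed
  also have "\<dots> \<le> 11 * real N" using N_pos by simp
  finally show ?thesis by (simp add: N_def power2_eq_square)
qed

text \<open>All costs are positive and a tree on at least two vertices has an edge. This makes the
  ratio of costs meaningful.\<close>

lemma mst_cost_pos: "0 < mst_cost G"
proof -
  have "0 < (\<Sum>e\<in>T. cost G e)" if T: "spanning_tree {..<n} E T" for T
  proof (rule sum_pos)
    show "finite T" using T finite_E finite_subset by (auto simp: spanning_tree_def)
    have "0 < K ^ 3" using K_pos by simp
    then have "1 < n" using n_gt by linarith
    then have "1 \<in> {..<n}" "0 \<in> {..<n}" by auto
    then obtain p where "is_path {..<n} T 1 p 0"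
      using T unfolding spanning_tree_def connected_graph_def by blast
    then have "p \<noteq> []" "hd p \<noteq> last p" "path_edges p \<subseteq> T" by (auto simp: is_path_def)
    then show "T \<noteq> {}" by (cases p rule: path_edges.cases) auto
  qed (rule cost_pos)
  then show ?thesis
    unfolding mst_cost_def using spanning_tree_reps finite_spanning_trees
    by (subst Min_gr_iff) auto
qed

end

section \<open>Choice of \<open>K\<close> and conclusion\<close>

lemma cube_bracket:
  assumes "2 \<le> (n::nat)"
  shows "\<exists>K>0. K ^ 3 < n \<and> n \<le> (K + 1) ^ 3"
proof -
  define m where "m = (LEAST m. n \<le> m ^ 3)"
  have "n \<le> n ^ 3" using power_increasing[of 1 3 n] assms by simp
  then have m: "n \<le> m ^ 3" unfolding m_def by (rule LeastI)
  have "2 \<le> m"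
  proof (rule ccontr)
    assume "\<not> 2 \<le> m"
    then have "m ^ 3 \<le> 1 ^ 3" by (intro power_mono) auto
    then show False using m assms by simp
  qed
  then have "\<not> n \<le> (m - 1) ^ 3" unfolding m_def by (intro not_less_Least) (simp add: m_def[symmetric])
  then show ?thesis using m \<open>2 \<le> m\<close> by (intro exI[of _ "m - 1"]) auto
qed

theorem theorem1:
  "\<exists>c::real. c > 0 \<and> (\<exists>n0::nat. \<forall>n\<ge>n0.
     \<exists>(G :: (nat, nat) broadcast) s.
       broadcast_game G \<and> card (verts G) = n \<and>
       (event G)\<^sup>*\<^sup>* Map.empty s \<and>
       nash_equilibrium G s \<and>
       0 < mst_cost G \<and>
       social_cost G s \<ge> c * real n powr (1/3) * mst_cost G)"
proof (intro exI[of _ "1 / 22 :: real"] conjI exI[of _ "2 :: nat"] allI impI)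
  fix n :: nat assume "2 \<le> n"
  then obtain K where K: "0 < K" "K ^ 3 < n" "n \<le> (K + 1) ^ 3" using cube_bracket by blast
  interpret layered K n by unfold_locales (use K in auto)
  obtain A where A: "reach A" "\<forall>a\<in>A. a mod n \<in> tops" "\<forall>p\<in>tops. cnt A p = n"
    using reach_uniform by blast
  have "real n \<le> real ((K + 1) ^ 3)" using K(3) of_nat_le_iff by blast
  also have "\<dots> = real (K + 1) powr 3" by (simp add: powr_numeral)
  finally have "real n powr (1/3) \<le> (real (K + 1) powr 3) powr (1/3)"
    by (intro powr_mono2) simp_all
  also have "\<dots> = real (K + 1)" unfolding powr_powr by simp
  also have "\<dots> \<le> 2 * real K" using K by simp
  \<comment> \<open>The constant is \<open>1 / (2 * 11)\<close>: the cube root of \<open>n\<close>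
    is at most \<open>2 * K\<close>, the tree costs at most \<open>11 * K ^ 2\<close>, and the state
    costs \<open>K ^ 3\<close>.\<close>
  finally have "1 / 22 * real n powr (1/3) * mst_cost G \<le> 1 / 22 * (2 * real K) * (11 * real K ^ 2)"
    using mst_cost_le[OF K(3)] mst_cost_pos by (intro mult_mono) auto
  also have "\<dots> = real K ^ 3" by (simp add: power2_eq_square power3_eq_cube)
  also have "\<dots> = social_cost G (st A)" using social_cost_uniform A by simp
  finally show "\<exists>(G :: (nat, nat) broadcast) s.
       broadcast_game G \<and> card (verts G) = n \<and>
       (event G)\<^sup>*\<^sup>* Map.empty s \<and>
       nash_equilibrium G s \<and>
       0 < mst_cost G \<and>
       social_cost G s \<ge> 1 / 22 * real n powr (1/3) * mst_cost G"
    using broadcast_game_G mst_cost_pos nash_if_uniform A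
    by (intro exI[of _ G] exI[of _ "st A"]) (auto simp: reach_def)
qed simp

end
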